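(* Let $\mathbb{G}$ be a stratified group and $\mathbb{M}$ a graded group, $\Omega\subset\mathbb{G}$ open, $f:\Omega\to\mathbb{M}$ continuously P-differentiable and $\overline x\in\Omega$. For $R>0$ let $D_R$ denote the closed ball of radius $R$ centered at the unit element (in the relevant group). (a) If $Df(\overline x)$ is an h-epimorphism with kernel $N$ admitting a complementary homogeneous subgroup, set $S=f^{-1}(f(\overline x))$. Then for every $R>0$, $D_R\cap\delta_{1/\lambda}(\overline x^{-1}S)\to D_R\cap N$ in the Hausdorff sense as $\lambda\to0^+$; in particular $\mathrm{Tan}(S,\overline x)=N$. (b) If $Df(\overline x)$ is an h-monomorphism with image $H$ and $H$ admits a normal complementary homogeneous subgroup in $\mathbb{M}$, then there is an open neighbourhood $V\subset\Omega$ of $\overline x$ such that, setting $S=f(V)$, for every $R>0$, $D_R\cap\delta_{1/\lambda}(f(\overline x)^{-1}S)\to D_R\cap H$ in the Hausdorff sense as $\lambda\to0^+$; in particular $\mathrm{Tan}(S,f(\overline x))=H$.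
   Context: Graded group: connected simply connected real Lie group with Lie algebra $V_1\oplus\cdots\oplus V_\iota$, $[V_i,V_j]\subset V_{i+j}$; stratified if $[V_i,V_j]=V_{i+j}$; dilations $\delta_r$ act by $r^i$ on $V_i$, also on the group via $\exp$. Homogeneous distances (fixed on both groups, used for balls) are continuous, left invariant and satisfy $d(\delta_rx,\delta_ry)=rd(x,y)$. h-homomorphism: group homomorphism commuting with dilations; h-epimorphism (resp. h-monomorphism): h-homomorphism with a right (resp. left) inverse that is an h-homomorphism. P-differentiable at $x$: there is an h-homomorphism $Df(x)$ with $\rho(f(x)^{-1}f(xh),Df(x)(h))/d(h,e)\to0$ as $h\to e$; continuously P-differentiable: everywhere P-differentiable with $x\mapsto\exp^{-1}\circ Df(x)\circ\exp$ continuous. Homogeneous subgroup: closed connected simply connected Lie subgroup invariant under dilations; $A,B$ complementary if $AB$ is the whole group and $A\cap B=\{e\}$. Homogeneous tangent cone: $\mathrm{Tan}(S,a)=\{v: v=\lim_k\delta_{r_k}(a^{-1}s_k)$ for some $r_k>0$, $s_k\in S$, $s_k\to a\}$. Hausdorff convergence refers to the Hausdorff distance between compact sets induced by the homogeneous distance. *)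

theory Defs
  imports "HOL-Analysis.Analysis"
begin

text \<open>A graded group is modelled in exponential coordinates: the underlying set is its
  Lie algebra (a finite dimensional real vector space, type class euclidean_space),
  exp is the identity, and the group law is the Baker-Campbell-Hausdorff product
  (Dynkin's formula, which is a finite sum since the algebra is nilpotent).
  The unit element is 0 and the inverse of x is -x.\<close>

record 'a grstr =
  gbr  :: "'a \<Rightarrow> 'a \<Rightarrow> 'a"
  gV   :: "nat \<Rightarrow> 'a set"
  gdeg :: nat

definition lie_bracket :: "('a::real_vector \<Rightarrow> 'a \<Rightarrow> 'a) \<Rightarrow> bool" where
  "lie_bracket b \<longleftrightarrow> bilinear b \<and> (\<forall>x y. b x y = - b y x)
     \<and> (\<forall>x y z. b x (b y z) + b y (b z x) + b z (b x y) = 0)"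

definition graded_group :: "'a::euclidean_space grstr \<Rightarrow> bool" where
  "graded_group G \<longleftrightarrow> lie_bracket (gbr G) \<and> 1 \<le> gdeg G
     \<and> (\<forall>i. subspace (gV G i))
     \<and> (\<forall>i. (i = 0 \<or> gdeg G < i) \<longrightarrow> gV G i = {0})
     \<and> (\<forall>x. \<exists>xs. (\<forall>i\<in>{1..gdeg G}. xs i \<in> gV G i) \<and> x = (\<Sum>i\<in>{1..gdeg G}. xs i))
     \<and> (\<forall>xs. (\<forall>i\<in>{1..gdeg G}. xs i \<in> gV G i) \<and> (\<Sum>i\<in>{1..gdeg G}. xs i) = 0
            \<longrightarrow> (\<forall>i\<in>{1..gdeg G}. xs i = 0))
     \<and> (\<forall>i j x y. x \<in> gV G i \<longrightarrow> y \<in> gV G j \<longrightarrow> gbr G x y \<in> gV G (i + j))"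

definition stratified_group :: "'a::euclidean_space grstr \<Rightarrow> bool" where
  "stratified_group G \<longleftrightarrow> graded_group G
     \<and> (\<forall>i j. 1 \<le> i \<longrightarrow> 1 \<le> j \<longrightarrow>
          span {gbr G x y | x y. x \<in> gV G i \<and> y \<in> gV G j} = gV G (i + j))"

fun nbr :: "('a \<Rightarrow> 'a \<Rightarrow> 'a) \<Rightarrow> 'a list \<Rightarrow> 'a::zero" where
  "nbr b [] = 0"
| "nbr b [x] = x"
| "nbr b (x # y # ys) = b x (nbr b (y # ys))"

definition dyn_word :: "(nat \<times> nat) list \<Rightarrow> 'a \<Rightarrow> 'a \<Rightarrow> 'a list" where
  "dyn_word rs x y = concat (map (\<lambda>(r, s). replicate r x @ replicate s y) rs)"

definition dyn_index :: "nat \<Rightarrow> nat \<Rightarrow> (nat \<times> nat) list set" where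
  "dyn_index m n = {rs. length rs = n \<and> (\<forall>(r, s)\<in>set rs. 1 \<le> r + s)
                         \<and> (\<Sum>(r, s)\<leftarrow>rs. r + s) \<le> m}"

text \<open>Dynkin's form of the BCH product, truncated at degree m (higher brackets vanish).\<close>
definition bch :: "('a::real_vector \<Rightarrow> 'a \<Rightarrow> 'a) \<Rightarrow> nat \<Rightarrow> 'a \<Rightarrow> 'a \<Rightarrow> 'a" where
  "bch b m x y = (\<Sum>n\<in>{1..m}. ((-1) ^ (n - 1) / real n) *\<^sub>R
      (\<Sum>rs\<in>dyn_index m n.
         (1 / (real (\<Sum>(r, s)\<leftarrow>rs. r + s) * (\<Prod>(r, s)\<leftarrow>rs. fact r * fact s))) *\<^sub>R
           nbr b (dyn_word rs x y)))"

definition mul :: "'a::real_vector grstr \<Rightarrow> 'a \<Rightarrow> 'a \<Rightarrow> 'a" where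
  "mul G x y = bch (gbr G) (gdeg G) x y"

definition comps :: "'a::real_vector grstr \<Rightarrow> 'a \<Rightarrow> nat \<Rightarrow> 'a" where
  "comps G x = (SOME xs. (\<forall>i\<in>{1..gdeg G}. xs i \<in> gV G i) \<and> x = (\<Sum>i\<in>{1..gdeg G}. xs i))"

definition dil :: "'a::real_vector grstr \<Rightarrow> real \<Rightarrow> 'a \<Rightarrow> 'a" where
  "dil G r x = (\<Sum>i\<in>{1..gdeg G}. (r ^ i) *\<^sub>R comps G x i)"

definition hom_dist :: "'a::euclidean_space grstr \<Rightarrow> ('a \<Rightarrow> 'a \<Rightarrow> real) \<Rightarrow> bool" where
  "hom_dist G d \<longleftrightarrow> (\<forall>x y. d x y = 0 \<longleftrightarrow> x = y) \<and> (\<forall>x y. d x y = d y x)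
     \<and> (\<forall>x y z. d x z \<le> d x y + d y z)
     \<and> continuous_on UNIV (\<lambda>p. d (fst p) (snd p))
     \<and> (\<forall>z x y. d (mul G z x) (mul G z y) = d x y)
     \<and> (\<forall>r>0. \<forall>x y. d (dil G r x) (dil G r y) = r * d x y)"

definition h_hom :: "'a::euclidean_space grstr \<Rightarrow> 'b::euclidean_space grstr \<Rightarrow> ('a \<Rightarrow> 'b) \<Rightarrow> bool" where
  "h_hom G M L \<longleftrightarrow> continuous_on UNIV L
     \<and> (\<forall>x y. L (mul G x y) = mul M (L x) (L y))
     \<and> (\<forall>r>0. \<forall>x. L (dil G r x) = dil M r (L x))"

definition h_epi :: "'a::euclidean_space grstr \<Rightarrow> 'b::euclidean_space grstr \<Rightarrow> ('a \<Rightarrow> 'b) \<Rightarrow> bool" where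
  "h_epi G M L \<longleftrightarrow> h_hom G M L \<and> (\<exists>R. h_hom M G R \<and> (\<forall>y. L (R y) = y))"

definition h_mono :: "'a::euclidean_space grstr \<Rightarrow> 'b::euclidean_space grstr \<Rightarrow> ('a \<Rightarrow> 'b) \<Rightarrow> bool" where
  "h_mono G M L \<longleftrightarrow> h_hom G M L \<and> (\<exists>P. h_hom M G P \<and> (\<forall>x. P (L x) = x))"

text \<open>P-differentiability of f at x with differential L (unit element is 0, inverse is -x).\<close>
definition P_diff :: "'a::euclidean_space grstr \<Rightarrow> 'b::euclidean_space grstr \<Rightarrow> ('a \<Rightarrow> 'a \<Rightarrow> real)
    \<Rightarrow> ('b \<Rightarrow> 'b \<Rightarrow> real) \<Rightarrow> ('a \<Rightarrow> 'b) \<Rightarrow> 'a \<Rightarrow> ('a \<Rightarrow> 'b) \<Rightarrow> bool" where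
  "P_diff G M d \<rho> f x L \<longleftrightarrow> h_hom G M L
     \<and> ((\<lambda>h. \<rho> (mul M (- f x) (f (mul G x h))) (L h) / d h 0) \<longlongrightarrow> 0) (at 0)"

text \<open>Homogeneous subgroup: closed, connected, simply connected subgroup invariant under
  dilations (closed subgroups are Lie subgroups by Cartan's theorem).\<close>
definition homog_subgroup :: "'a::euclidean_space grstr \<Rightarrow> 'a set \<Rightarrow> bool" where
  "homog_subgroup G W \<longleftrightarrow> closed W \<and> 0 \<in> W
     \<and> (\<forall>x\<in>W. \<forall>y\<in>W. mul G x y \<in> W) \<and> (\<forall>x\<in>W. - x \<in> W)
     \<and> connected W \<and> simply_connected W
     \<and> (\<forall>r>0. dil G r ` W \<subseteq> W)"

definition complementary :: "'a::euclidean_space grstr \<Rightarrow> 'a set \<Rightarrow> 'a set \<Rightarrow> bool" where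
  "complementary G A B \<longleftrightarrow> {mul G a b | a b. a \<in> A \<and> b \<in> B} = UNIV \<and> A \<inter> B = {0}"

definition normal_sub :: "'a::euclidean_space grstr \<Rightarrow> 'a set \<Rightarrow> bool" where
  "normal_sub G W \<longleftrightarrow> (\<forall>g. \<forall>w\<in>W. mul G (mul G g w) (- g) \<in> W)"

definition Tan :: "'a::euclidean_space grstr \<Rightarrow> 'a set \<Rightarrow> 'a \<Rightarrow> 'a set" where
  "Tan G S a = {v. \<exists>r s. (\<forall>k. 0 < r k) \<and> (\<forall>k. s k \<in> S) \<and> s \<longlonglongrightarrow> a
                     \<and> (\<lambda>k. dil G (r k) (mul G (- a) (s k))) \<longlonglongrightarrow> v}"

definition hdist :: "('a \<Rightarrow> 'a \<Rightarrow> real) \<Rightarrow> 'a set \<Rightarrow> 'a set \<Rightarrow> real" where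
  "hdist d A B = max (SUP a\<in>A. INF b\<in>B. d a b) (SUP b\<in>B. INF a\<in>A. d a b)"

definition dball :: "('a::zero \<Rightarrow> 'a \<Rightarrow> real) \<Rightarrow> real \<Rightarrow> 'a set" where
  "dball d R = {x. d x 0 \<le> R}"

end

theory Submission
  imports Defs
begin

text \<open>P-differentiability at the base point \<open>x\<close> says that the rescaled maps
  \<open>h \<mapsto> \<delta>\<^bsub>1/t\<^esub>(f(x)\<^bsup>-1\<^esup> f(x \<delta>\<^bsub>t\<^esub> h))\<close> converge to \<open>L = Df(x)\<close> uniformly on bounded sets.
  If \<open>L\<close> has a right inverse \<open>R\<close>, blown-up points \<open>p\<close> of the level set have small \<open>L p\<close>, so
  \<open>p R(L p)\<^bsup>-1\<^esup>\<close> is a nearby kernel element; conversely, over a kernel element \<open>v\<close> the rescaled map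
  restricted to the fibre \<open>v R(m)\<close> is close to the identity in \<open>m\<close>, and Brouwer's theorem gives a
  zero near \<open>v\<close>. If \<open>L\<close> has a left inverse, then \<open>d(h, 0) \<le> C \<rho>(L h, 0)\<close>, so on a small ball \<open>f\<close>
  expands distances from \<open>x\<close> by a definite factor, and the blow-ups of the image converge by the
  uniform convergence of the rescaled maps.\<close>

section \<open>Polynomial dependence of the Baker-Campbell-Hausdorff product\<close>

lemma polynomial_function_bounded_linear_compose:
  fixes h :: "'b::real_normed_vector \<Rightarrow> 'c::real_normed_vector"
  assumes "bounded_linear h" "polynomial_function p"
  shows "polynomial_function (\<lambda>t. h (p t))"
  unfolding polynomial_function_def o_def
proof (intro allI impI)
  fix f :: "'c \<Rightarrow> real" assume "bounded_linear f"
  then have "bounded_linear (\<lambda>y. f (h y))"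
    using assms(1) by (rule bounded_linear_compose)
  then show "real_polynomial_function (\<lambda>t. f (h (p t)))"
    using assms(2) unfolding polynomial_function_def o_def by blast
qed

text \<open>Expanding the first argument in the basis leaves a finite sum of real polynomials times
  linear images of \<open>q t\<close>.\<close>

lemma polynomial_function_bilinear:
  fixes b :: "'a::euclidean_space \<Rightarrow> 'b::euclidean_space \<Rightarrow> 'c::real_normed_vector"
  assumes b: "bilinear b" and p: "polynomial_function p" and q: "polynomial_function q"
  shows "polynomial_function (\<lambda>t. b (p t) (q t))"
proof -
  have lin: "linear (\<lambda>x. b x y)" "linear (b x)" for x y
    using b by (simp_all add: bilinear_def)
  have "b (p t) (q t) = (\<Sum>i\<in>Basis. (p t \<bullet> i) *\<^sub>R b i (q t))" for t
  proof -
    have "b (p t) (q t) = b (\<Sum>i\<in>Basis. (p t \<bullet> i) *\<^sub>R i) (q t)"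
      by (simp add: euclidean_representation)
    also have "\<dots> = (\<Sum>i\<in>Basis. (p t \<bullet> i) *\<^sub>R b i (q t))"
      by (simp add: linear_sum[OF lin(1)] bilinear_lmul[OF b])
    finally show ?thesis .
  qed
  moreover have "polynomial_function (\<lambda>t. (p t \<bullet> i) *\<^sub>R b i (q t))" for i
    by (intro polynomial_function_mult polynomial_function_bounded_linear_compose[OF _ q]
          polynomial_function_bounded_linear_compose[OF _ p] bounded_linear_inner_left
          linear_conv_bounded_linear[THEN iffD1] lin)
  ultimately show ?thesis
    by (simp add: polynomial_function_sum)
qed

text \<open>In each coordinate, a nonzero coefficient of positive degree would make the polynomial
  unbounded. This is the Liouville principle behind \<open>mul_minus_cancel\<close>.\<close>

lemma bounded_polynomial_function_constant:
  fixes g :: "real \<Rightarrow> 'a::euclidean_space"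
  assumes g: "polynomial_function g" and bdd: "bounded (range g)"
  shows "g s = g t"
proof (rule euclidean_eqI)
  fix i :: 'a assume "i \<in> Basis"
  then have "real_polynomial_function (\<lambda>x. g x \<bullet> i)"
    using g polynomial_function_iff_Basis_inner by blast
  then obtain a n where a: "\<And>x. g x \<bullet> i = (\<Sum>k\<le>n. a k * x ^ k)"
    unfolding real_polynomial_function_iff_sum by meson
  obtain B where B: "\<And>x. norm (g x) \<le> B"
    using bdd by (auto simp: bounded_iff)
  have "a k = 0" if k: "1 \<le> k" "k \<le> n" for k
  proof (rule ccontr)
    assume "a k \<noteq> 0"
    then have "eventually (\<lambda>x. norm (\<Sum>k\<le>n. a k * x ^ k) \<ge> B + 1) at_infinity"
      using k by (intro Limits.polyfun_extremal) auto
    then obtain x where "norm (\<Sum>k\<le>n. a k * x ^ k) \<ge> B + 1"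
      by (auto simp: eventually_at_infinity) (metis abs_ge_self)
    then have "\<bar>g x \<bullet> i\<bar> \<ge> B + 1"
      by (simp add: a)
    moreover have "\<bar>g x \<bullet> i\<bar> \<le> B"
      using Basis_le_norm[OF \<open>i \<in> Basis\<close>, of "g x"] B[of x] by linarith
    ultimately show False by simp
  qed
  then have "a k * x ^ k = a k * y ^ k" if "k \<le> n" for k x y
    using that by (cases k) auto
  then have "(\<Sum>k\<le>n. a k * s ^ k) = (\<Sum>k\<le>n. a k * t ^ k)"
    by (intro sum.cong) auto
  then show "g s \<bullet> i = g t \<bullet> i"
    by (simp add: a)
qed

lemma polynomial_function_nbr:
  fixes b :: "'a::euclidean_space \<Rightarrow> 'a \<Rightarrow> 'a"
  assumes "bilinear b" "\<forall>p\<in>set ps. polynomial_function p"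
  shows "polynomial_function (\<lambda>t. nbr b (map (\<lambda>p. p t) ps))"
  using assms(2)
proof (induction ps)
  case (Cons p ps)
  then show ?case
    by (cases ps) (auto intro: polynomial_function_bilinear[OF assms(1)])
qed simp

text \<open>Turns a word in the values at \<open>t\<close> into the values of a word of functions,
  the shape that \<open>polynomial_function_nbr\<close> handles.\<close>

lemma dyn_word_apply: "dyn_word rs (p t) (q t) = map (\<lambda>f. f t) (dyn_word rs p q)"
  by (auto simp: dyn_word_def map_concat intro!: arg_cong[of _ _ concat])

lemma dyn_word_Nil [simp]: "dyn_word [] x y = []"
  by (simp add: dyn_word_def)

lemma dyn_word_Cons [simp]:
  "dyn_word ((r, s) # rs) x y = replicate r x @ replicate s y @ dyn_word rs x y"
  by (simp add: dyn_word_def)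

lemma set_dyn_word: "w \<in> set (dyn_word rs x y) \<Longrightarrow> w = x \<or> w = y"
  by (induction rs) auto

lemma length_dyn_word: "length (dyn_word rs x y) = (\<Sum>(r, s)\<leftarrow>rs. r + s)"
  by (induction rs) (auto simp: dyn_word_def)

text \<open>Each \<open>r + s\<close> is one summand of a total of at most \<open>m\<close>, which
  bounds all entries. Finiteness matters because a sum over an infinite set would be 0.\<close>

lemma finite_dyn_index: "finite (dyn_index m n)"
proof (rule finite_subset)
  show "dyn_index m n \<subseteq> {rs. set rs \<subseteq> {..m} \<times> {..m} \<and> length rs = n}"
  proof (clarsimp simp: dyn_index_def)
    fix rs :: "(nat \<times> nat) list" and r s
    assume "(\<Sum>(r, s)\<leftarrow>rs. r + s) \<le> m" "(r, s) \<in> set rs"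
    then show "r \<le> m \<and> s \<le> m"
      using member_le_sum_list[of "r + s" "map (\<lambda>(r, s). r + s) rs"] by force
  qed
  show "finite {rs. set rs \<subseteq> {..m} \<times> {..m} \<and> length rs = n}"
    by (intro finite_lists_length_eq) simp
qed

lemma polynomial_function_bch:
  fixes b :: "'a::euclidean_space \<Rightarrow> 'a \<Rightarrow> 'a"
  assumes "bilinear b" "polynomial_function p" "polynomial_function q"
  shows "polynomial_function (\<lambda>t. bch b m (p t) (q t))"
proof -
  have "polynomial_function (\<lambda>t. nbr b (dyn_word rs (p t) (q t)))" for rs
    unfolding dyn_word_apply
    using set_dyn_word[of _ rs p q] assms(2,3) by (intro polynomial_function_nbr[OF assms(1)]) blast
  then show ?thesis
    unfolding bch_def
    by (intro polynomial_function_sum polynomial_function_cmul finite_dyn_index finite_atLeastAtMost)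
qed

section \<open>The product along a line through the unit\<close>

lemma nbr_collinear:
  assumes b: "bilinear b" and alt: "b z z = 0" and ws: "set ws \<subseteq> range (\<lambda>c. c *\<^sub>R z)"
  shows "nbr b ws \<in> range (\<lambda>c. c *\<^sub>R z) \<and> (2 \<le> length ws \<longrightarrow> nbr b ws = 0)"
  using ws
\<comment> \<open>Membership in the line is carried along so that the outermost bracket is always a
  bracket of two multiples of \<open>z\<close>.\<close>
proof (induction ws)
  case Nil
  then show ?case by (auto intro: range_eqI[of _ _ 0])
next
  case (Cons x ys)
  then obtain c d where c: "x = c *\<^sub>R z" "nbr b ys = d *\<^sub>R z" by auto
  have "b (c *\<^sub>R z) (d *\<^sub>R z) = 0"
    by (simp add: bilinear_lmul[OF b] bilinear_rmul[OF b] alt)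
  with c show ?case by (cases ys) (auto intro: range_eqI[of _ _ 0])
qed

text \<open>Multiples of \<open>z\<close> commute, so only the words of length one contribute to
  Dynkin's sum.\<close>

lemma bch_collinear:
  fixes b :: "'a::real_vector \<Rightarrow> 'a \<Rightarrow> 'a"
  assumes b: "bilinear b" and alt: "b z z = 0" and m: "1 \<le> m"
  shows "bch b m (s *\<^sub>R z) (t *\<^sub>R z) = (s + t) *\<^sub>R z"
proof -
  define T where "T rs = (1 / (real (\<Sum>(r, s)\<leftarrow>rs. r + s) * (\<Prod>(r, s)\<leftarrow>rs. fact r * fact s))) *\<^sub>R
           nbr b (dyn_word rs (s *\<^sub>R z) (t *\<^sub>R z))" for rs
  have T0: "T rs = 0" if "2 \<le> (\<Sum>(r, s)\<leftarrow>rs. r + s)" for rs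
  proof -
    have "set (dyn_word rs (s *\<^sub>R z) (t *\<^sub>R z)) \<subseteq> range (\<lambda>c. c *\<^sub>R z)"
      using set_dyn_word by fast
    then show ?thesis
      using nbr_collinear[OF b alt] that unfolding T_def
      by (metis length_dyn_word scaleR_zero_right)
  qed
  \<comment> \<open>Every pair contributes at least one letter, so two or more pairs give a word on
    which \<open>T\<close> vanishes by \<open>T0\<close>.\<close>
  have len: "length rs \<le> (\<Sum>(r, s)\<leftarrow>rs. r + s)" if "\<forall>(r, s)\<in>set rs. 1 \<le> r + s" 
    for rs :: "(nat \<times> nat) list"
    using that by (induction rs) auto
  have "(\<Sum>rs\<in>dyn_index m n. T rs) = 0" if "n \<noteq> 1" "n \<in> {1..m}" for n
  proof (intro sum.neutral ballI T0)
    fix rs assume "rs \<in> dyn_index m n"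
    then show "2 \<le> (\<Sum>(r, s)\<leftarrow>rs. r + s)"
      using len[of rs] that by (auto simp: dyn_index_def)
  qed
  then have "bch b m (s *\<^sub>R z) (t *\<^sub>R z) =
      (\<Sum>n\<in>{1}. ((-1) ^ (n - 1) / real n) *\<^sub>R (\<Sum>rs\<in>dyn_index m n. T rs))"
    unfolding bch_def T_def[symmetric] using m
    by (intro sum.mono_neutral_right) auto
  also have "\<dots> = (\<Sum>rs\<in>dyn_index m 1. T rs)" by simp
  also have "\<dots> = (\<Sum>rs\<in>{[(1, 0)], [(0, 1)]}. T rs)"
  proof (intro sum.mono_neutral_right finite_dyn_index ballI T0)
    show "{[(1, 0)], [(0, 1)]} \<subseteq> dyn_index m 1"
      using m by (auto simp: dyn_index_def)
    fix rs assume "rs \<in> dyn_index m 1 - {[(1, 0)], [(0, 1)]}"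
    then show "2 \<le> (\<Sum>(r, s)\<leftarrow>rs. r + s)"
      by (auto simp: dyn_index_def length_Suc_conv)
  qed
  also have "\<dots> = (s + t) *\<^sub>R z"
    by (simp add: T_def dyn_word_def scaleR_add_left)
  finally show ?thesis .
qed

section \<open>Homogeneous distances\<close>

locale homogeneous_group =
  fixes G :: "'a::euclidean_space grstr" and d :: "'a \<Rightarrow> 'a \<Rightarrow> real"
  assumes graded: "graded_group G" and hom_dist: "hom_dist G d"
begin

lemma bilinear_gbr: "bilinear (gbr G)"
  using graded by (simp add: graded_group_def lie_bracket_def)

lemma gbr_self: "gbr G x x = 0"
proof -
  have "\<forall>x y. gbr G x y = - gbr G y x"
    using graded unfolding graded_group_def lie_bracket_def by (elim conjE)
  then have "gbr G x x = - gbr G x x" by (elim allE)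
  then have "2 *\<^sub>R gbr G x x = 0"
    unfolding scaleR_2 by (simp only: eq_neg_iff_add_eq_0)
  then show ?thesis by simp
qed

text \<open>Lines through 0 are one-parameter subgroups. The unit and inverse laws below are the
  cases with coefficients 0, 1 and -1.\<close>

lemma mul_collinear: "mul G (s *\<^sub>R x) (t *\<^sub>R x) = (s + t) *\<^sub>R x"
  unfolding mul_def
  using graded by (intro bch_collinear bilinear_gbr gbr_self) (simp add: graded_group_def)

lemma mul_zero_right [simp]: "mul G x 0 = x"
  using mul_collinear[of 1 x 0] by simp

lemma mul_zero_left [simp]: "mul G 0 x = x"
  using mul_collinear[of 0 x 1] by simp

lemma mul_minus_right [simp]: "mul G x (- x) = 0"
  using mul_collinear[of 1 x "- 1"] by simp

lemma mul_minus_left [simp]: "mul G (- x) x = 0"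
  using mul_collinear[of "- 1" x 1] by simp

lemma polynomial_function_mul:
  "polynomial_function p \<Longrightarrow> polynomial_function q \<Longrightarrow> polynomial_function (\<lambda>t. mul G (p t) (q t))"
  unfolding mul_def by (intro polynomial_function_bch bilinear_gbr)

lemma continuous_on_mul: "continuous_on A (mul G x)"
  by (intro continuous_on_polymonial_function polynomial_function_mul
      polynomial_function_const polynomial_function_id)

section \<open>Graded components and dilations\<close>

lemma subspace_gV: "subspace (gV G i)"
  using graded by (simp add: graded_group_def)

lemma comps: "i \<in> {1..gdeg G} \<Longrightarrow> comps G x i \<in> gV G i" "(\<Sum>i\<in>{1..gdeg G}. comps G x i) = x"
proof -
  have "\<exists>xs. (\<forall>i\<in>{1..gdeg G}. xs i \<in> gV G i) \<and> x = (\<Sum>i\<in>{1..gdeg G}. xs i)"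
    using graded unfolding graded_group_def by blast
  from someI_ex[OF this] show "i \<in> {1..gdeg G} \<Longrightarrow> comps G x i \<in> gV G i"
    "(\<Sum>i\<in>{1..gdeg G}. comps G x i) = x"
    unfolding comps_def[symmetric] by auto
qed

text \<open>The difference of two decompositions decomposes 0, hence vanishes. As
  \<open>comps\<close> is an arbitrary choice, its linearity and its behaviour under dilations are
  derived from this.\<close>

lemma comps_unique:
  assumes "\<And>i. i \<in> {1..gdeg G} \<Longrightarrow> xs i \<in> gV G i" "(\<Sum>i\<in>{1..gdeg G}. xs i) = x" "i \<in> {1..gdeg G}"
  shows "comps G x i = xs i"
proof -
  have mem: "\<forall>i\<in>{1..gdeg G}. comps G x i - xs i \<in> gV G i"
    using comps(1) assms(1) by (auto intro: subspace_diff[OF subspace_gV])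
  have sum0: "(\<Sum>i\<in>{1..gdeg G}. comps G x i - xs i) = 0"
    unfolding sum_subtractf assms(2) comps(2) by simp
  have "\<forall>ys. (\<forall>i\<in>{1..gdeg G}. ys i \<in> gV G i) \<and> (\<Sum>i\<in>{1..gdeg G}. ys i) = 0
      \<longrightarrow> (\<forall>i\<in>{1..gdeg G}. ys i = 0)"
    using graded unfolding graded_group_def by blast
  from this[THEN spec, THEN mp, OF conjI, OF mem sum0]
  have "\<forall>i\<in>{1..gdeg G}. comps G x i - xs i = 0" .
  with assms(3) show ?thesis by auto
qed

lemma linear_comps:
  assumes "i \<in> {1..gdeg G}" shows "linear (\<lambda>x. comps G x i)"
proof (rule linearI)
  show "comps G (x + y) i = comps G x i + comps G y i" for x y
    using assms comps by (intro comps_unique) (auto simp: sum.distrib intro: subspace_add[OF subspace_gV])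
  show "comps G (c *\<^sub>R x) i = c *\<^sub>R comps G x i" for c x
    using assms comps by (intro comps_unique)
      (auto simp: scaleR_sum_right[symmetric] intro: subspace_scale[OF subspace_gV])
qed

lemma comps_dil: "i \<in> {1..gdeg G} \<Longrightarrow> comps G (dil G r x) i = r ^ i *\<^sub>R comps G x i"
  using comps(1) by (intro comps_unique) (auto simp: dil_def intro: subspace_scale[OF subspace_gV])

lemma dil_dil: "dil G r (dil G s x) = dil G (r * s) x"
proof -
  have "dil G r (dil G s x) = (\<Sum>i\<in>{1..gdeg G}. r ^ i *\<^sub>R comps G (dil G s x) i)"
    by (rule dil_def)
  also have "\<dots> = (\<Sum>i\<in>{1..gdeg G}. (r * s) ^ i *\<^sub>R comps G x i)"
    by (intro sum.cong refl) (simp only: comps_dil scaleR_scaleR power_mult_distrib)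
  also have "\<dots> = dil G (r * s) x"
    by (rule dil_def[symmetric])
  finally show ?thesis .
qed

lemma dil_1 [simp]: "dil G 1 x = x"
  by (simp add: dil_def comps del: One_nat_def)

lemma dil_inverse [simp]: "r \<noteq> 0 \<Longrightarrow> dil G (1 / r) (dil G r x) = x" "r \<noteq> 0 \<Longrightarrow> dil G r (dil G (1 / r) x) = x"
  by (simp_all add: dil_dil)

lemma linear_dil: "linear (dil G r)"
  unfolding dil_def
  by (intro linear_compose_sum linear_compose_scale_right linear_comps ballI)

lemma dil_zero_right [simp]: "dil G r 0 = 0"
  using linear_dil linear_0 by blast

text \<open>Degrees start at 1, so every power \<open>0 ^ i\<close> vanishes. Dilations thus
  contract continuously to the unit as \<open>r\<close> decreases to 0.\<close>

lemma dil_zero_left [simp]: "dil G 0 x = 0"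
  unfolding dil_def by (intro sum.neutral) auto

lemma continuous_on_dil:
  assumes "continuous_on A f" "continuous_on A g"
  shows "continuous_on A (\<lambda>t. dil G (f t) (g t))"
  unfolding dil_def
  by (intro continuous_on_sum continuous_on_scaleR continuous_on_power assms(1)
      bounded_linear.continuous_on[OF _ assms(2)] linear_conv_bounded_linear[THEN iffD1] linear_comps)

section \<open>Metric properties of the homogeneous distance\<close>

lemma d_eq_0 [simp]: "d x y = 0 \<longleftrightarrow> x = y"
  and d_sym: "d x y = d y x"
  and d_triangle: "d x z \<le> d x y + d y z"
  and continuous_d: "continuous_on UNIV (\<lambda>p. d (fst p) (snd p))"
  and d_mul: "d (mul G z x) (mul G z y) = d x y"
  and d_dil: "r > 0 \<Longrightarrow> d (dil G r x) (dil G r y) = r * d x y"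
  using hom_dist unfolding hom_dist_def by blast+

lemma d_nonneg [simp]: "0 \<le> d x y"
proof -
  have "d x x = 0" by (simp only: d_eq_0)
  then show ?thesis using d_triangle[of x x y] d_sym[of x y] by linarith
qed

lemma d_pos: "x \<noteq> y \<Longrightarrow> 0 < d x y"
  using d_nonneg[of x y] d_eq_0[of x y] by linarith

lemma d_self [simp]: "d x x = 0"
  by simp

lemma d_dil_0: "r > 0 \<Longrightarrow> d (dil G r x) 0 = r * d x 0"
  using d_dil[of r x 0] by simp

lemma d_mul_self: "d (mul G x y) x = d y 0"
  using d_mul[of x y 0] by simp

lemma d_mul_minus: "d (mul G (- x) y) 0 = d y x"
  using d_mul[of "- x" y x] by simp

lemma d_uminus: "d (- x) 0 = d x 0"
  using d_mul[of x "- x" 0] d_sym[of 0 x] by simp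

lemma continuous_on_d:
  assumes "continuous_on A f" "continuous_on A g"
  shows "continuous_on A (\<lambda>t. d (f t) (g t))"
  using continuous_on_compose2[OF continuous_d continuous_on_Pair[OF assms]] by simp

lemma tendsto_d: "(u \<longlongrightarrow> y) F \<Longrightarrow> ((\<lambda>k. d (u k) z) \<longlongrightarrow> d y z) F"
  using continuous_on_d[OF continuous_on_id continuous_on_const, of UNIV z]
  by (intro isCont_tendsto_compose[of y "\<lambda>w. d w z" u]) (auto simp: continuous_on_eq_continuous_at)

text \<open>By compactness \<open>d\<close> has a positive minimum distance to 0 on the Euclidean
  sphere of radius \<open>e\<close>. A point outside that sphere can be contracted onto it, which
  does not increase its distance to 0.\<close>

lemma d_small_imp_norm_small:
  assumes "0 < e" obtains c where "0 < c" "\<And>x. d x 0 < c \<Longrightarrow> norm x < e"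
proof -
  have comp: "compact (sphere (0::'a) e)" and ne: "sphere (0::'a) e \<noteq> {}"
    using assms by auto
  obtain x0 where x0: "x0 \<in> sphere 0 e" "\<And>y. y \<in> sphere 0 e \<Longrightarrow> d x0 0 \<le> d y 0"
    using continuous_attains_inf[OF comp ne continuous_on_d[OF continuous_on_id continuous_on_const]]
    by blast
  have "x0 \<noteq> 0" using x0(1) assms by auto
  show ?thesis
  proof
    show "0 < d x0 0" using \<open>x0 \<noteq> 0\<close> by (rule d_pos)
    fix x assume x: "d x 0 < d x0 0"
    show "norm x < e"
    proof (rule ccontr)
      assume "\<not> norm x < e"
      \<comment> \<open>Intermediate value theorem: the norm of \<open>dil G r x\<close> runs from 0
        at \<open>r = 0\<close> to \<open>norm x\<close> at \<open>r = 1\<close>.\<close>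
      then obtain r where r: "0 \<le> r" "r \<le> 1" "norm (dil G r x) = e"
        using IVT'[of "\<lambda>r. norm (dil G r x)" 0 e 1, OF _ _ _ continuous_on_norm[OF
              continuous_on_dil[OF continuous_on_id continuous_on_const]]] assms
        by auto
      then have "r > 0" using assms by (cases "r = 0") auto
      then have "d x0 0 \<le> r * d x 0"
        using x0(2)[of "dil G r x"] r by (simp add: d_dil_0)
      also have "\<dots> \<le> d x 0" using r by (simp add: mult_left_le_one_le)
      finally show False using x by simp
    qed
  qed
qed

text \<open>A small dilation carries the ball into the Euclidean unit ball; its inverse is linear,
  hence preserves boundedness.\<close>

lemma bounded_dball: "bounded (dball d R)"
proof -
  obtain c where c: "0 < c" "\<And>x. d x 0 < c \<Longrightarrow> norm x < 1"
    using d_small_imp_norm_small[of 1] by auto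
  \<comment> \<open>The absolute value admits any sign of \<open>R\<close>; the added 1 makes
    \<open>r * \<bar>R\<bar> < c\<close> strict.\<close>
  define r where "r = c / (\<bar>R\<bar> + 1)"
  have r: "0 < r" using c by (simp add: r_def)
  have "dball d R \<subseteq> dil G (1 / r) ` ball 0 1"
  proof
    fix x assume "x \<in> dball d R"
    then have "d (dil G r x) 0 \<le> r * \<bar>R\<bar>"
      using r by (auto simp: dball_def d_dil_0)
    also have "\<dots> < c" using c(1) by (simp add: r_def field_simps)
    finally have "dil G r x \<in> ball 0 1" using c by simp
    then show "x \<in> dil G (1 / r) ` ball 0 1"
      using r by (intro image_eqI[of _ _ "dil G r x"]) auto
  qed
  moreover have "bounded (dil G (1 / r) ` ball 0 1)"
    by (intro bounded_linear_image bounded_ball linear_conv_bounded_linear[THEN iffD1] linear_dil)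
  ultimately show ?thesis by (rule bounded_subset[rotated])
qed

lemma compact_dball: "compact (dball d R)"
proof -
  have "closed (dball d R)"
    unfolding dball_def
    by (intro closed_Collect_le continuous_on_d continuous_on_const continuous_on_id)
  then show ?thesis using bounded_dball compact_eq_bounded_closed by blast
qed

text \<open>A Liouville argument: \<open>t \<mapsto> (t x) ((- t x) y)\<close> is polynomial, and bounded because left
  translations are isometries; hence it is constant. This replaces associativity of the
  Baker-Campbell-Hausdorff product, of which only this cancellation law is needed.\<close>

lemma mul_minus_cancel [simp]: "mul G x (mul G (- x) y) = y"
proof -
  define g where "g t = mul G (t *\<^sub>R x) (mul G ((- t) *\<^sub>R x) y)" for t
  have "polynomial_function g"
    unfolding g_def
    by (intro polynomial_function_mul polynomial_function_mult polynomial_function_const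
        polynomial_function_id polynomial_function_minus)
  moreover have "bounded (range g)"
  proof (rule bounded_subset[OF bounded_dball])
    have "d (g t) 0 = d y 0" for t
    proof -
      have "d (g t) 0 = d (g t) (mul G (t *\<^sub>R x) (- (t *\<^sub>R x)))" by simp
      also have "\<dots> = d (mul G (- (t *\<^sub>R x)) y) (- (t *\<^sub>R x))"
        unfolding g_def by (simp add: d_mul del: mul_minus_right)
      also have "\<dots> = d y 0"
        by (rule d_mul_self)
      finally show ?thesis .
    qed
    then show "range g \<subseteq> dball d (d y 0)" by (auto simp: dball_def)
  qed
  ultimately have "g 1 = g 0" by (rule bounded_polynomial_function_constant)
  then show ?thesis by (simp add: g_def)
qed

lemma minus_mul_cancel [simp]: "mul G (- x) (mul G x y) = y"
  using mul_minus_cancel[of "- x" y] by simp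

text \<open>The pairs in \<open>Q\<close>, at Euclidean distance at least \<open>e\<close>, form a
  compact set off the diagonal, so \<open>d\<close> is bounded below on it by a positive
  constant.\<close>

lemma d_small_imp_close:
  assumes "compact K" "0 < e"
  obtains c where "0 < c" "\<And>x y. x \<in> K \<Longrightarrow> d x y < c \<Longrightarrow> dist x y < e"
proof -
  have "compact ((\<lambda>x. d x 0) ` K)"
    using assms(1) by (intro compact_continuous_image continuous_on_d continuous_on_const continuous_on_id)
  then obtain R where R: "\<And>x. x \<in> K \<Longrightarrow> d x 0 \<le> R"
    by (auto dest!: compact_imp_bounded simp: bounded_real) (meson abs_le_D1)
  define Q where "Q = (K \<times> dball d (R + 1)) \<inter> {p. e \<le> dist (fst p) (snd p)}"
  have "closed {p::'a\<times>'a. e \<le> dist (fst p) (snd p)}"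
    by (intro closed_Collect_le continuous_intros)
  then have Q: "compact Q"
    unfolding Q_def by (intro compact_Int_closed compact_Times assms compact_dball)
  obtain c where c: "0 < c" "\<And>p. p \<in> Q \<Longrightarrow> c \<le> d (fst p) (snd p)"
  proof (cases "Q = {}")
    case False
    obtain p where p: "p \<in> Q" "\<And>q. q \<in> Q \<Longrightarrow> d (fst p) (snd p) \<le> d (fst q) (snd q)"
      using continuous_attains_inf[OF Q False continuous_on_subset[OF continuous_d]] by auto
    have "fst p \<noteq> snd p" using p(1) assms(2) by (auto simp: Q_def)
    with p that[of "d (fst p) (snd p)"] show ?thesis by (simp add: d_pos)
  qed (use that[of 1] in auto)
  show ?thesis
  proof
    \<comment> \<open>The cap 1 forces \<open>y\<close> into the ball of radius \<open>R + 1\<close>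
      that enters \<open>Q\<close>.\<close>
    show "0 < min c 1" using c by simp
    fix x y assume x: "x \<in> K" and xy: "d x y < min c 1"
    have "d y 0 \<le> R + 1"
      using d_triangle[of y 0 x] R[OF x] d_sym[of x y] xy by linarith
    then show "dist x y < e"
      using c(2)[of "(x, y)"] x xy by (force simp: Q_def dball_def)
  qed
qed

lemma tendsto_d_imp_tendsto:
  assumes "((\<lambda>k. d (u k) x) \<longlongrightarrow> 0) F"
  shows "(u \<longlongrightarrow> x) F"
proof (rule tendstoI)
  fix e :: real assume "0 < e"
  then obtain c where c: "0 < c" "\<And>y. d x y < c \<Longrightarrow> dist x y < e"
    using d_small_imp_close[of "{x}" e] by (metis compact_sing insertI1)
  from order_tendstoD(2)[OF assms c(1)] show "\<forall>\<^sub>F k in F. dist (u k) x < e"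
    by eventually_elim (metis c(2) d_sym dist_commute)
qed

lemma tendsto_mul: "(u \<longlongrightarrow> y) F \<Longrightarrow> ((\<lambda>k. mul G x (u k)) \<longlongrightarrow> mul G x y) F"
  using continuous_on_mul[of UNIV x] by (simp add: continuous_on_eq_continuous_at isCont_tendsto_compose)

text \<open>Uniform continuity on a compact set, compared with the parameter 1 where the
  displacement is 0. It bounds the cost of pulling points slightly inward.\<close>

lemma dball_dil_close:
  assumes "0 < e" obtains s where "0 < s" "s < 1" "\<And>x. x \<in> dball d R \<Longrightarrow> d (dil G (1 - s) x) x < e"
proof -
  let ?K = "{0..1::real} \<times> dball d R"
  have "uniformly_continuous_on ?K (\<lambda>p. d (dil G (fst p) (snd p)) (snd p))"
    by (intro compact_uniformly_continuous compact_Times compact_dball compact_Icc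
        continuous_on_d continuous_on_dil continuous_intros)
  then obtain \<delta> where \<delta>: "0 < \<delta>" "\<And>p q. p \<in> ?K \<Longrightarrow> q \<in> ?K \<Longrightarrow> dist q p < \<delta> \<Longrightarrow>
      dist (d (dil G (fst q) (snd q)) (snd q)) (d (dil G (fst p) (snd p)) (snd p)) < e"
    unfolding uniformly_continuous_on_def using assms by meson
  define s where "s = min (\<delta> / 2) (1 / 2)"
  have s: "0 < s" "s < 1" "s < \<delta>" using \<delta>(1) by (auto simp: s_def)
  have "d (dil G (1 - s) x) x < e" if "x \<in> dball d R" for x
    using \<delta>(2)[of "(1, x)" "(1 - s, x)"] s that by (simp add: dist_Pair_Pair dist_real_def)
  with s that show ?thesis by blast
qed

end

section \<open>Estimates for h-homomorphisms\<close>

lemma h_hom_continuous: "h_hom G M L \<Longrightarrow> continuous_on A L"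
  unfolding h_hom_def by (blast intro: continuous_on_subset)

lemma h_hom_mul: "h_hom G M L \<Longrightarrow> L (mul G x y) = mul M (L x) (L y)"
  by (simp add: h_hom_def)

lemma h_hom_dil: "h_hom G M L \<Longrightarrow> 0 < r \<Longrightarrow> L (dil G r x) = dil M r (L x)"
  by (simp add: h_hom_def)

text \<open>\<open>L 0\<close> is fixed by the dilation of factor 2, which doubles its distance to
  0.\<close>

lemma h_hom_zero:
  assumes "homogeneous_group G dG" "homogeneous_group M dM" "h_hom G M L"
  shows "L 0 = 0"
proof -
  interpret G: homogeneous_group G dG by fact
  interpret M: homogeneous_group M dM by fact
  have "L (dil G 2 0) = dil M 2 (L 0)"
    using assms(3) by (rule h_hom_dil) simp
  then have "dM (L 0) 0 = 2 * dM (L 0) 0"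
    using M.d_dil_0[of 2 "L 0"] by simp
  then show ?thesis by simp
qed

text \<open>Compactness bounds \<open>L\<close> on the unit ball, and rescaling an arbitrary nonzero
  point to distance 1 extends the bound by homogeneity.\<close>

lemma h_hom_bound:
  assumes "homogeneous_group G dG" "homogeneous_group M dM" "h_hom G M L"
  obtains C where "0 < C" "\<And>x. dM (L x) 0 \<le> C * dG x 0"
proof -
  interpret G: homogeneous_group G dG by fact
  interpret M: homogeneous_group M dM by fact
  have "continuous_on (dball dG 1) (\<lambda>x. dM (L x) 0)"
    by (intro M.continuous_on_d continuous_on_const h_hom_continuous[OF assms(3)])
  then have "bounded ((\<lambda>x. dM (L x) 0) ` dball dG 1)"
    by (intro compact_imp_bounded compact_continuous_image G.compact_dball)
  then obtain C where C: "\<And>x. x \<in> dball dG 1 \<Longrightarrow> dM (L x) 0 \<le> C"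
    by (auto simp: bounded_real)
  show ?thesis
  proof
    \<comment> \<open>The maximum guarantees positivity, as \<open>C\<close> can be 0 for the
      trivial homomorphism.\<close>
    show "0 < max C 1" by simp
    fix x show "dM (L x) 0 \<le> max C 1 * dG x 0"
    proof (cases "x = 0")
      case True
      then show ?thesis using h_hom_zero[OF assms] by simp
    next
      case False
      define r where "r = 1 / dG x 0"
      have r: "0 < r" using G.d_pos[OF False] by (simp add: r_def)
      have "r * dM (L x) 0 = dM (L (dil G r x)) 0"
        using r by (simp add: h_hom_dil[OF assms(3)] M.d_dil_0)
      also have "\<dots> \<le> C"
        using False r by (intro C) (simp add: dball_def G.d_dil_0 r_def)
      finally have "dM (L x) 0 \<le> C * dG x 0"
        using G.d_pos[OF False] by (simp add: r_def field_simps)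
      also have "\<dots> \<le> max C 1 * dG x 0"
        by (intro mult_right_mono) auto
      finally show ?thesis .
    qed
  qed
qed

section \<open>Blow-ups\<close>

text \<open>Real suprema and infima are informative only for nonempty bounded sets. Nonnegativity
  and the pointwise estimates supply the bounds.\<close>

lemma hdist_bounds:
  assumes nonneg: "\<And>a b. 0 \<le> d a b" and ne: "A \<noteq> {}" "B \<noteq> {}"
    and AB: "\<And>a. a \<in> A \<Longrightarrow> \<exists>b\<in>B. d a b \<le> e" and BA: "\<And>b. b \<in> B \<Longrightarrow> \<exists>a\<in>A. d a b \<le> e"
  shows "0 \<le> hdist d A B" "hdist d A B \<le> e"
proof -
  have bdd: "bdd_below (d a ` X)" "bdd_below ((\<lambda>x. d x a) ` X)" for a X
    using nonneg by (auto intro!: bdd_belowI[of _ 0])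
  have 1: "0 \<le> (INF b\<in>B. d a b)" "0 \<le> (INF a\<in>A. d a b)" for a b
    using ne nonneg by (auto intro!: cINF_greatest)
  have 2: "(INF b\<in>B. d a b) \<le> e" if "a \<in> A" for a
    using AB[OF that] bdd by (auto intro: cINF_lower2)
  have 3: "(INF a\<in>A. d a b) \<le> e" if "b \<in> B" for b
    using BA[OF that] bdd by (auto intro: cINF_lower2)
  show "hdist d A B \<le> e"
    unfolding hdist_def using ne 2 3 by (auto intro!: cSUP_least)
  obtain a where "a \<in> A" using ne by auto
  then have "0 \<le> (SUP a\<in>A. INF b\<in>B. d a b)"
    using 1 2 by (intro cSUP_upper2[of _ A a]) (auto intro!: bdd_aboveI[of _ e])
  then show "0 \<le> hdist d A B"
    by (simp add: hdist_def)
qed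

context homogeneous_group
begin

definition blowup :: "'a set \<Rightarrow> 'a \<Rightarrow> real \<Rightarrow> 'a set" where
  "blowup S x t = dil G (1 / t) ` (mul G (- x) ` S)"

text \<open>Invariance is under the group dilations, not under scalar multiples. The instances are
  kernels and images of differentials.\<close>

definition cone :: "'a set \<Rightarrow> bool" where
  "cone C \<longleftrightarrow> closed C \<and> 0 \<in> C \<and> (\<forall>r>0. \<forall>x\<in>C. dil G r x \<in> C)"

text \<open>A relaxed local Hausdorff convergence: the approximating point may leave the ball of
  radius \<open>R\<close>. This form is easier to verify and still yields both the truncated
  convergence and the tangent cone.\<close>

definition blowup_limit :: "'a set \<Rightarrow> 'a \<Rightarrow> 'a set \<Rightarrow> bool" where
  "blowup_limit S x C \<longleftrightarrow> (\<forall>R>0. \<forall>e>0. \<exists>t\<^sub>0>0. \<forall>t. 0 < t \<and> t < t\<^sub>0 \<longrightarrow>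
      (\<forall>a\<in>blowup S x t \<inter> dball d R. \<exists>q\<in>C. d a q < e) \<and>
      (\<forall>q\<in>C \<inter> dball d R. \<exists>a\<in>blowup S x t. d a q < e))"

lemma zero_in_blowup: "x \<in> S \<Longrightarrow> 0 \<in> blowup S x t"
  unfolding blowup_def by (metis dil_zero_right image_eqI mul_minus_left)

text \<open>Approximants are contracted by a dilation so that they stay in the closed ball.\<close>

lemma hdist_blowup_tendsto:
  assumes C: "cone C" and lim: "blowup_limit S x C" and "x \<in> S" "0 < R"
  shows "((\<lambda>t. hdist d (dball d R \<inter> blowup S x t) (dball d R \<inter> C)) \<longlongrightarrow> 0) (at_right 0)"
proof (rule tendstoI)
  fix e :: real assume "0 < e"
  then obtain s where s: "0 < s" "s < 1" "\<And>x. x \<in> dball d (R + 1) \<Longrightarrow> d (dil G (1 - s) x) x < e / 4"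
    using dball_dil_close[of "e / 4" "R + 1"] by auto
  \<comment> \<open>The bound \<open>e / 4\<close> shares the error with the contraction, 1 keeps
    \<open>q\<close> in the ball where \<open>s\<close> was chosen, and \<open>s * R\<close> is the
    radial excess that the contraction can absorb.\<close>
  define \<eta> where "\<eta> = min (e / 4) (min 1 (s * R))"
  have \<eta>: "0 < \<eta>" "\<eta> \<le> e / 4" "\<eta> \<le> 1" "\<eta> \<le> s * R"
    using \<open>0 < e\<close> s \<open>0 < R\<close> by (auto simp: \<eta>_def)
  obtain t\<^sub>0 where t\<^sub>0: "0 < t\<^sub>0" and
    upper: "\<And>t a. 0 < t \<Longrightarrow> t < t\<^sub>0 \<Longrightarrow> a \<in> blowup S x t \<Longrightarrow> a \<in> dball d R \<Longrightarrow> \<exists>q\<in>C. d a q < \<eta>" and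
    lower: "\<And>t q. 0 < t \<Longrightarrow> t < t\<^sub>0 \<Longrightarrow> q \<in> C \<Longrightarrow> q \<in> dball d R \<Longrightarrow> \<exists>a\<in>blowup S x t. d a q < \<eta>"
    using lim \<open>0 < R\<close> \<eta>(1) unfolding blowup_limit_def by (metis IntI)
  have C_dil: "dil G (1 - s) q \<in> C" if "q \<in> C" for q
    using C that s by (simp add: cone_def)
  have "dist (hdist d (dball d R \<inter> blowup S x t) (dball d R \<inter> C)) 0 < e" if t: "0 < t" "t < t\<^sub>0" for t
  proof -
    let ?A = "dball d R \<inter> blowup S x t" and ?B = "dball d R \<inter> C"
    have "0 \<in> ?A" "0 \<in> ?B"
      using zero_in_blowup[OF \<open>x \<in> S\<close>] C \<open>0 < R\<close> by (auto simp: dball_def cone_def)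
    then have ne: "?A \<noteq> {}" "?B \<noteq> {}" by auto
    \<comment> \<open>Here the approximant is found first and contracted afterwards:
      \<open>(1 - s) * (R + s * R) \<le> R\<close>.\<close>
    have up: "\<exists>b\<in>?B. d a b \<le> e / 2" if aA: "a \<in> ?A" for a
    proof -
      obtain q where q: "q \<in> C" "d a q < \<eta>" using upper[OF t] aA by blast
      have a: "d a 0 \<le> R" using aA by (simp add: dball_def)
      then have q0: "d q 0 \<le> R + \<eta>"
        using d_triangle[of q 0 a] d_sym[of a q] q(2) by linarith
      then have near: "d (dil G (1 - s) q) q < e / 4"
        using \<eta>(3) by (intro s(3)) (simp add: dball_def)
      have "d (dil G (1 - s) q) 0 = (1 - s) * d q 0"
        using s by (intro d_dil_0) simp
      also have "\<dots> \<le> (1 - s) * (R + s * R)"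
        using s q0 \<eta>(4) by (intro mult_left_mono) auto
      also have "\<dots> = R - s * s * R" by (simp add: algebra_simps)
      also have "\<dots> \<le> R" using s \<open>0 < R\<close> by simp
      finally have "dil G (1 - s) q \<in> ?B" using C_dil[OF q(1)] by (simp add: dball_def)
      moreover have "d a (dil G (1 - s) q) \<le> e / 2"
        using d_triangle[of a "dil G (1 - s) q" q] near d_sym[of "dil G (1 - s) q" q] q(2) \<eta>(2) by linarith
      ultimately show ?thesis by blast
    qed
    \<comment> \<open>Here \<open>q\<close> is contracted first, leaving a margin
      \<open>s * R\<close> for the approximation error.\<close>
    have low: "\<exists>a\<in>?A. d a q \<le> e / 2" if "q \<in> ?B" for q
    proof -
      have q: "q \<in> C" "d q 0 \<le> R" using that by (auto simp: dball_def)
      have near: "d (dil G (1 - s) q) q < e / 4"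
        using q by (intro s(3)) (simp add: dball_def)
      have "d (dil G (1 - s) q) 0 = (1 - s) * d q 0"
        using s by (intro d_dil_0) simp
      also have "\<dots> \<le> (1 - s) * R"
        using s q by (intro mult_left_mono) auto
      finally have q': "d (dil G (1 - s) q) 0 \<le> R - s * R" by (simp add: algebra_simps)
      moreover have "0 \<le> s * R" using s \<open>0 < R\<close> by simp
      ultimately have "dil G (1 - s) q \<in> dball d R" by (simp add: dball_def)
      then obtain a where a: "a \<in> blowup S x t" "d a (dil G (1 - s) q) < \<eta>"
        using lower[OF t C_dil[OF q(1)]] by blast
      have "d a 0 \<le> R"
        using d_triangle[of a 0 "dil G (1 - s) q"] q' a(2) \<eta>(4) by linarith
      then have "a \<in> ?A" using a(1) by (simp add: dball_def)
      moreover have "d a q \<le> e / 2"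
        using d_triangle[of a q "dil G (1 - s) q"] near a(2) \<eta>(2) by linarith
      ultimately show ?thesis by blast
    qed
    show ?thesis
      using hdist_bounds[of d, OF d_nonneg ne up low] \<open>0 < e\<close> by (simp add: dist_real_def)
  qed
  then show "\<forall>\<^sub>F t in at_right 0. dist (hdist d (dball d R \<inter> blowup S x t) (dball d R \<inter> C)) 0 < e"
    using t\<^sub>0 by (auto simp: eventually_at_right_field)
qed

section \<open>Tangent cones of sets with a blow-up limit\<close>

lemma Tan_subset_of_blowup_limit:
  assumes C: "cone C" and lim: "blowup_limit S x C"
  shows "Tan G S x \<subseteq> C"
proof
  fix v assume "v \<in> Tan G S x"
  then obtain r s where r: "\<And>k. 0 < r k" and s: "\<And>k. s k \<in> S" "s \<longlonglongrightarrow> x"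
    and v: "(\<lambda>k. dil G (r k) (mul G (- x) (s k))) \<longlonglongrightarrow> v"
    unfolding Tan_def by blast
  define a where "a k = dil G (r k) (mul G (- x) (s k))" for k
  have a: "a \<longlonglongrightarrow> v" using v by (simp add: a_def[abs_def])
  have h: "(\<lambda>k. d (mul G (- x) (s k)) 0) \<longlonglongrightarrow> 0"
    using tendsto_d[OF s(2), of x] by (simp add: d_mul_minus)
  show "v \<in> C"
  \<comment> \<open>Bounded scales force the limit 0, since \<open>s\<close> tends to
    \<open>x\<close>. Otherwise \<open>1 / r k\<close> is arbitrarily small infinitely often, and
    \<open>a k\<close> lies in a blow-up at that scale.\<close>
  proof (cases "\<exists>B. \<forall>\<^sub>F k in sequentially. r k \<le> B")
    case True
    then obtain B where "\<forall>\<^sub>F k in sequentially. r k \<le> B" by blast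
    then have "\<forall>\<^sub>F k in sequentially. norm (d (a k) 0) \<le> B * d (mul G (- x) (s k)) 0"
      by eventually_elim (simp add: a_def d_dil_0[OF r] abs_mult abs_of_pos[OF r] mult_right_mono)
    then have "(\<lambda>k. d (a k) 0) \<longlonglongrightarrow> 0"
      by (rule Lim_null_comparison) (use tendsto_mult_left[OF h, of B] in simp)
    then have "a \<longlonglongrightarrow> 0" by (rule tendsto_d_imp_tendsto)
    then have "v = 0" using a LIMSEQ_unique by blast
    then show ?thesis using C by (simp add: cone_def)
  next
    case False
    have "v \<in> closure C"
      unfolding closure_approachable
    proof (intro allI impI)
      fix e :: real assume "0 < e"
      then obtain c where c: "0 < c" "\<And>y. d v y < c \<Longrightarrow> dist v y < e"
        using d_small_imp_close[of "{v}" e] by (metis compact_sing insertI1)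
      obtain t\<^sub>0 where t\<^sub>0: "0 < t\<^sub>0" and
        upper: "\<And>t a. 0 < t \<Longrightarrow> t < t\<^sub>0 \<Longrightarrow> a \<in> blowup S x t \<Longrightarrow> a \<in> dball d (d v 0 + 1) \<Longrightarrow> \<exists>q\<in>C. d a q < c / 2"
        using lim[unfolded blowup_limit_def, rule_format, of "d v 0 + 1" "c / 2"] c(1)
          add_nonneg_pos[OF d_nonneg[of v 0] zero_less_one] by (metis IntI half_gt_zero)
      have "\<exists>\<^sub>F k in sequentially. 1 / t\<^sub>0 < r k"
        using False by (auto simp: frequently_def not_less)
      moreover have "\<forall>\<^sub>F k in sequentially. d (a k) v < c / 2"
        using order_tendstoD(2)[OF tendsto_d[OF a, of v], of "c / 2"] c(1) by simp
      moreover have "\<forall>\<^sub>F k in sequentially. d (a k) 0 < d v 0 + 1"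
        using order_tendstoD(2)[OF tendsto_d[OF a, of 0], of "d v 0 + 1"] by simp
      ultimately obtain k where k: "1 / t\<^sub>0 < r k" "d (a k) v < c / 2" "d (a k) 0 < d v 0 + 1"
        using frequently_ex[OF frequently_eventually_frequently[OF frequently_eventually_frequently]]
        by blast
      have "a k \<in> blowup S x (1 / r k)"
        using s(1) by (auto simp: blowup_def a_def)
      moreover have "1 / r k < t\<^sub>0"
        using k(1) t\<^sub>0 r[of k] by (simp add: field_simps)
      ultimately obtain q where q: "q \<in> C" "d (a k) q < c / 2"
        using upper[of "1 / r k" "a k"] r[of k] k(3) by (auto simp: dball_def)
      then have "d v q < c"
        using d_triangle[of v q "a k"] d_sym[of v "a k"] k(2) by linarith
      then show "\<exists>y\<in>C. dist y v < e"
        using c(2) q(1) by (metis dist_commute)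
    qed
    then show ?thesis using C by (simp add: cone_def)
  qed
qed

text \<open>Approximants of \<open>v\<close> at scales \<open>t k\<close> below
  \<open>1 / Suc k\<close> converge to \<open>v\<close>. Undoing the dilation puts their sources at
  distance \<open>t k * d (a k) 0\<close> from \<open>x\<close>, which tends to 0.\<close>

lemma subset_Tan_of_blowup_limit:
  assumes lim: "blowup_limit S x C"
  shows "C \<subseteq> Tan G S x"
proof
  fix v assume v: "v \<in> C"
  have "\<exists>t a. 0 < t \<and> t < 1 / Suc k \<and> a \<in> blowup S x t \<and> d a v < 1 / Suc k" for k
  proof -
    obtain t\<^sub>0 where t\<^sub>0: "0 < t\<^sub>0" and
      lower: "\<And>t. 0 < t \<Longrightarrow> t < t\<^sub>0 \<Longrightarrow> \<forall>q\<in>C \<inter> dball d (d v 0 + 1). \<exists>a\<in>blowup S x t. d a q < 1 / Suc k"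
      using lim[unfolded blowup_limit_def, rule_format, of "d v 0 + 1" "1 / Suc k"]
        add_nonneg_pos[OF d_nonneg[of v 0] zero_less_one] by auto
    define t where "t = min t\<^sub>0 (1 / Suc k) / 2"
    have t: "0 < t" "t < t\<^sub>0" "t < 1 / Suc k"
      using t\<^sub>0 by (auto simp: t_def min_def field_simps)
    moreover have "v \<in> dball d (d v 0 + 1)" by (simp add: dball_def)
    ultimately show ?thesis using lower[of t] v by blast
  qed
  then obtain t a where t: "\<And>k. 0 < t k" "\<And>k. t k < 1 / Suc k"
    and a: "\<And>k. a k \<in> blowup S x (t k)" "\<And>k. d (a k) v < 1 / Suc k"
    by metis
  from a(1) have "\<exists>s\<in>S. a k = dil G (1 / t k) (mul G (- x) s)" for k
    by (auto simp: blowup_def)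
  then obtain s where s: "\<And>k. s k \<in> S" "\<And>k. a k = dil G (1 / t k) (mul G (- x) (s k))"
    by metis
  have null: "(\<lambda>k. 1 / real (Suc k)) \<longlonglongrightarrow> 0"
    using LIMSEQ_inverse_real_of_nat by (simp add: inverse_eq_divide)
  have "(\<lambda>k. d (a k) v) \<longlonglongrightarrow> 0"
    by (rule Lim_null_comparison[OF _ null]) (use a(2) in \<open>auto intro!: always_eventually less_imp_le\<close>)
  then have "a \<longlonglongrightarrow> v" by (rule tendsto_d_imp_tendsto)
  moreover have "s \<longlonglongrightarrow> x"
  proof (rule tendsto_d_imp_tendsto)
    have "d (s k) x \<le> 1 / Suc k * (d v 0 + 1)" for k
    proof -
      have "dil G (t k) (a k) = mul G (- x) (s k)"
        using t(1)[of k] by (simp add: s(2))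
      then have "d (s k) x = t k * d (a k) 0"
        using d_dil_0[OF t(1), of k "a k"] by (simp add: d_mul_minus)
      also have "\<dots> \<le> 1 / Suc k * (d v 0 + 1)"
      proof (rule mult_mono)
        have "1 / real (Suc k) \<le> 1" by simp
        then show "d (a k) 0 \<le> d v 0 + 1"
          using d_triangle[of "a k" 0 v] a(2)[of k] by linarith
      qed (use t(2)[of k] in auto)
      finally show ?thesis .
    qed
    then show "(\<lambda>k. d (s k) x) \<longlonglongrightarrow> 0"
      by (intro Lim_null_comparison[OF _ tendsto_mult_left_zero[OF null, of "d v 0 + 1"]]
          always_eventually) auto
  qed
  ultimately show "v \<in> Tan G S x"
    unfolding Tan_def using s(1) t(1)
    by (intro CollectI exI[of _ "\<lambda>k. 1 / t k"] exI[of _ s]) (auto simp flip: s(2))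
qed

lemma Tan_eq_of_blowup_limit: "cone C \<Longrightarrow> blowup_limit S x C \<Longrightarrow> Tan G S x = C"
  using Tan_subset_of_blowup_limit subset_Tan_of_blowup_limit by blast

end

section \<open>Blow-ups of level sets and images\<close>

locale homogeneous_pair =
  G: homogeneous_group G dG + M: homogeneous_group M dM
  for G :: "'g::euclidean_space grstr" and dG and M :: "'m::euclidean_space grstr" and dM
begin

lemmas hom_zero = h_hom_zero[OF G.homogeneous_group_axioms M.homogeneous_group_axioms]
lemmas hom_bound = h_hom_bound[OF G.homogeneous_group_axioms M.homogeneous_group_axioms]
lemmas hom_bound_rev = h_hom_bound[OF M.homogeneous_group_axioms G.homogeneous_group_axioms]
lemmas hom_zero_rev = h_hom_zero[OF M.homogeneous_group_axioms G.homogeneous_group_axioms]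

text \<open>Multiplying out the quotient includes \<open>h = 0\<close>, and
  \<open>d_small_imp_norm_small\<close> replaces the Euclidean neighbourhood by a homogeneous ball,
  which scales under dilations.\<close>

lemma P_diff_bound:
  assumes P: "P_diff G M dG dM f x L" and U: "open U" "x \<in> U" and "0 < e"
  obtains c where "0 < c" "\<And>h. dG h 0 < c \<Longrightarrow>
    mul G x h \<in> U \<and> dM (mul M (- f x) (f (mul G x h))) (L h) \<le> e * dG h 0"
proof -
  have L: "h_hom G M L"
    and lim: "((\<lambda>h. dM (mul M (- f x) (f (mul G x h))) (L h) / dG h 0) \<longlongrightarrow> 0) (at 0)"
    using P by (auto simp: P_diff_def)
  have "\<forall>\<^sub>F h in at 0. dM (mul M (- f x) (f (mul G x h))) (L h) / dG h 0 < e"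
    using order_tendstoD(2)[OF lim \<open>0 < e\<close>] .
  moreover have "\<forall>\<^sub>F h in at 0. mul G x h \<in> U"
    using topological_tendstoD[OF G.tendsto_mul[OF tendsto_ident_at] U(1)] U(2) by simp
  ultimately have "\<forall>\<^sub>F h in at 0. mul G x h \<in> U \<and>
      dM (mul M (- f x) (f (mul G x h))) (L h) / dG h 0 < e"
    by eventually_elim simp
  then obtain \<delta> where \<delta>: "0 < \<delta>" "\<And>h. h \<noteq> 0 \<Longrightarrow> dist h 0 < \<delta> \<Longrightarrow> mul G x h \<in> U \<and>
      dM (mul M (- f x) (f (mul G x h))) (L h) / dG h 0 < e"
    unfolding eventually_at by blast
  obtain c where c: "0 < c" "\<And>h. dG h 0 < c \<Longrightarrow> norm h < \<delta>"
    using G.d_small_imp_norm_small[OF \<delta>(1)] by blast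
  show ?thesis
  proof
    fix h assume h: "dG h 0 < c"
    show "mul G x h \<in> U \<and> dM (mul M (- f x) (f (mul G x h))) (L h) \<le> e * dG h 0"
    proof (cases "h = 0")
      case True
      then show ?thesis using U hom_zero[OF L] by simp
    next
      case False
      then show ?thesis
        using \<delta>(2)[OF False] c(2)[OF h] G.d_pos[OF False] by (simp add: field_simps less_imp_le)
    qed
  qed fact
qed

text \<open>Accuracy 1 in \<open>P_diff_bound\<close> and the bound on \<open>L\<close> give a
  Lipschitz estimate at \<open>x\<close> with constant \<open>1 + C\<close>.\<close>

lemma P_diff_isCont:
  assumes P: "P_diff G M dG dM f x L"
  shows "isCont f x"
proof -
  have L: "h_hom G M L" using P by (simp add: P_diff_def)
  obtain C where C: "0 < C" "\<And>h. dM (L h) 0 \<le> C * dG h 0" using hom_bound[OF L] by blast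
  obtain c where c: "0 < c" "\<And>h. dG h 0 < c \<Longrightarrow>
      dM (mul M (- f x) (f (mul G x h))) (L h) \<le> 1 * dG h 0"
    using P_diff_bound[OF P open_UNIV UNIV_I zero_less_one] by metis
  have lim: "((\<lambda>y. dG y x) \<longlongrightarrow> 0) (at x)"
    using G.tendsto_d[OF tendsto_ident_at, of x x] by simp
  from order_tendstoD(2)[OF this c(1)]
  have "\<forall>\<^sub>F y in at x. norm (dM (f y) (f x)) \<le> (1 + C) * dG y x"
  proof eventually_elim
    case (elim y)
    define h where "h = mul G (- x) y"
    have y: "mul G x h = y" "dG h 0 = dG y x" by (simp_all add: h_def G.d_mul_minus)
    have "dM (f y) (f x) = dM (mul M (- f x) (f y)) 0" by (simp add: M.d_mul_minus)
    also have "\<dots> \<le> dM (mul M (- f x) (f y)) (L h) + dM (L h) 0" by (rule M.d_triangle)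
    also have "\<dots> \<le> dG y x + C * dG y x"
      using c(2)[of h] C(2)[of h] elim y by simp
    finally show ?case by (simp add: algebra_simps)
  qed
  then have "((\<lambda>y. dM (f y) (f x)) \<longlongrightarrow> 0) (at x)"
    by (rule Lim_null_comparison) (use tendsto_mult_right_zero[OF lim, of "1 + C"] in simp)
  then show ?thesis
    unfolding isCont_def by (rule M.tendsto_d_imp_tendsto)
qed

lemma cone_kernel:
  assumes L: "h_hom G M L"
  shows "G.cone {h. L h = 0}"
  unfolding G.cone_def
  by (auto simp: hom_zero[OF L] h_hom_dil[OF L]
      intro!: closed_Collect_eq h_hom_continuous[OF L] continuous_on_const)

text \<open>The left inverse exhibits the image as the fixed point set of \<open>L\<close> after
  \<open>P\<close>, hence as a closed set.\<close>

lemma cone_range: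
  assumes L: "h_hom G M L" and P: "h_hom M G P" and PL: "\<And>x. P (L x) = x"
  shows "M.cone (range L)"
proof -
  have "range L = {y. L (P y) = y}" using PL by (auto intro: range_eqI[OF sym])
  moreover have "closed {y. L (P y) = y}"
    by (intro closed_Collect_eq continuous_on_compose2[OF h_hom_continuous[OF L, of UNIV]]
        h_hom_continuous[OF P] continuous_on_id subset_UNIV)
  ultimately have "closed (range L)" by simp
  then show ?thesis
    unfolding M.cone_def using rangeI[of L 0] by (auto simp: hom_zero[OF L] simp flip: h_hom_dil[OF L])
qed

text \<open>Stands in for an implicit function theorem: differentiability at \<open>x\<close>
  controls the rescaled maps, and continuity on \<open>U\<close> makes Brouwer's theorem
  available.\<close>

lemma level_set_blowup_limit:
  assumes U: "open U" "x \<in> U" and f: "continuous_on U f" and df: "P_diff G M dG dM f x L"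
    and R: "h_hom M G R" and LR: "\<And>y. L (R y) = y"
  shows "G.blowup_limit {y\<in>U. f y = f x} x {h. L h = 0}"
  unfolding G.blowup_limit_def
proof (intro allI impI)
  fix K e :: real assume K: "0 < K" and e: "0 < e"
  have L: "h_hom G M L" using df by (simp add: P_diff_def)
  let ?S = "{y\<in>U. f y = f x}"
  obtain C where C: "0 < C" "\<And>y. dG (R y) 0 \<le> C * dM y 0" using hom_bound_rev[OF R] by blast
  \<comment> \<open>Chosen so that the correction by \<open>R\<close>, of size at most
    \<open>C * (\<epsilon> * K)\<close>, equals \<open>e / 2\<close>.\<close>
  define \<epsilon> where "\<epsilon> = e / (2 * C * K)"
  have \<epsilon>: "0 < \<epsilon>" "C * (\<epsilon> * K) < e" using e C K by (simp_all add: \<epsilon>_def)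
  obtain c where c: "0 < c" "\<And>h. dG h 0 < c \<Longrightarrow>
      mul G x h \<in> U \<and> dM (mul M (- f x) (f (mul G x h))) (L h) \<le> \<epsilon> * dG h 0"
    using P_diff_bound[OF df U \<epsilon>(1)] by blast
  have upper: "\<exists>q\<in>{h. L h = 0}. dG a q < e"
    if t: "0 < t" "t < c / K" and a: "a \<in> G.blowup ?S x t \<inter> dball dG K" for t a
  proof -
    obtain s where s: "f s = f x" "a = dil G (1 / t) (mul G (- x) s)"
      using a by (auto simp: G.blowup_def)
    have a0: "dG a 0 \<le> K" using a by (simp add: dball_def)
    define h where "h = mul G (- x) s"
    have h: "h = dil G t a" "mul G x h = s" using t by (simp_all add: s h_def)
    have h0: "dG h 0 = t * dG a 0" unfolding h(1) using t(1) by (rule G.d_dil_0)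
    have "dG h 0 \<le> t * K" unfolding h0 using a0 t by (intro mult_left_mono) auto
    also have "t * K < c" using t K by (simp add: field_simps)
    finally have "dM 0 (L h) \<le> \<epsilon> * dG h 0" using c(2)[of h] unfolding h(2) s(1) M.mul_minus_left by blast
    then have "t * dM (L a) 0 \<le> t * (\<epsilon> * dG a 0)"
      using M.d_dil_0[OF t(1), of "L a"] by (simp add: G.d_dil_0[OF t(1)] h(1) h_hom_dil[OF L t(1)] M.d_sym[of 0] algebra_simps)
    then have "dM (L a) 0 \<le> \<epsilon> * dG a 0" using t by simp
    also have "\<dots> \<le> \<epsilon> * K" using a0 \<epsilon> by (intro mult_left_mono) auto
    finally have La: "dM (L a) 0 \<le> \<epsilon> * K" .
    \<comment> \<open>Since \<open>-\<close> is the group inverse and \<open>L\<close> inverts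
      \<open>R\<close>, the right factor cancels \<open>L a\<close> and moves \<open>a\<close> only
      by the size of \<open>R (- L a)\<close>.\<close>
    define q where "q = mul G a (R (- L a))"
    have "L q = 0" by (simp add: q_def h_hom_mul[OF L] LR)
    moreover have "dG a q < e"
    proof -
      have "dG a q = dG (R (- L a)) 0"
        unfolding q_def by (subst G.d_sym) (rule G.d_mul_self)
      also have "\<dots> \<le> C * dM (L a) 0" using C(2)[of "- L a"] by (simp add: M.d_uminus)
      also have "\<dots> \<le> C * (\<epsilon> * K)" using La C by (intro mult_left_mono) auto
      finally show ?thesis using \<epsilon>(2) by simp
    qed
    ultimately show ?thesis by blast
  qed
  have "((\<lambda>m. dG (R m) 0) \<longlongrightarrow> dG (R 0) 0) (at 0)"
    using h_hom_continuous[OF R, of UNIV] by (intro G.tendsto_d) (simp add: continuous_on_def)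
  \<comment> \<open>The bound \<open>e\<close> gives the final closeness; the bound 1 keeps the
    fibre points within distance \<open>K + 1\<close> of the unit.\<close>
  then have "\<forall>\<^sub>F m in at 0. dG (R m) 0 < min e 1"
    using e by (intro order_tendstoD(2)[of _ 0]) (simp_all add: hom_zero_rev[OF R])
  then obtain \<eta>' where \<eta>': "0 < \<eta>'" "\<And>m. m \<noteq> 0 \<Longrightarrow> dist m 0 < \<eta>' \<Longrightarrow> dG (R m) 0 < min e 1"
    unfolding eventually_at by blast
  define \<eta> where "\<eta> = \<eta>' / 2"
  have \<eta>: "0 < \<eta>" using \<eta>' by (simp add: \<eta>_def)
  have R_small: "dG (R m) 0 < min e 1" if "m \<in> cball 0 \<eta>" for m
    using \<eta>'(2)[of m] \<eta>'(1) that e by (cases "m = 0") (auto simp: \<eta>_def hom_zero_rev[OF R])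
  obtain c1 where c1: "0 < c1" "\<And>m y. m \<in> cball 0 \<eta> \<Longrightarrow> dM m y < c1 \<Longrightarrow> dist m y < \<eta>"
    using M.d_small_imp_close[OF compact_cball \<eta>] by blast
  \<comment> \<open>Makes the rescaled error \<open>c1 / 2\<close>, below the threshold for a
    Euclidean displacement less than \<open>\<eta>\<close>.\<close>
  define \<epsilon>' where "\<epsilon>' = c1 / 2 / (K + 1)"
  have "K + 1 \<noteq> 0" using K by linarith
  then have "\<epsilon>' * (K + 1) = c1 / 2"
    using \<epsilon>'_def nonzero_eq_divide_eq by blast
  then have \<epsilon>': "0 < \<epsilon>'" "\<epsilon>' * (K + 1) < c1"
    using c1(1) K by (simp add: \<epsilon>'_def, linarith)
  obtain c2 where c2: "0 < c2" "\<And>h. dG h 0 < c2 \<Longrightarrow>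
      mul G x h \<in> U \<and> dM (mul M (- f x) (f (mul G x h))) (L h) \<le> \<epsilon>' * dG h 0"
    using P_diff_bound[OF df U \<epsilon>'(1)] by blast
  text \<open>On the fibre \<open>m \<mapsto> v R(m)\<close> the rescaled map \<open>F\<close> is uniformly close to the identity, so
    \<open>m \<mapsto> m - F m\<close> has a Brouwer fixed point, which is a zero of \<open>F\<close>.\<close>
  have lower: "\<exists>a\<in>G.blowup ?S x t. dG a v < e"
    if t: "0 < t" "t < c2 / (K + 1)" and v: "L v = 0" "dG v 0 \<le> K" for t v
  proof -
    \<comment> \<open>\<open>u\<close> lives in blown-up coordinates, \<open>p\<close> is the
      matching point near \<open>x\<close>, and \<open>F\<close> is the rescaled value of
      \<open>f\<close> there. As \<open>L v = 0\<close>, the linear model of \<open>F\<close> is the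
      identity.\<close>
    define u where "u m = mul G v (R m)" for m
    define p where "p m = mul G x (dil G t (u m))" for m
    define F where "F m = dil M (1 / t) (mul M (- f x) (f (p m)))" for m
    have Lu: "L (u m) = m" for m
      by (simp add: u_def h_hom_mul[OF L] LR v)
    have uv: "dG (u m) v < min e 1" if "m \<in> cball 0 \<eta>" for m
      using R_small[OF that] by (simp add: u_def G.d_mul_self)
    have main: "p m \<in> U \<and> dM (mul M (- f x) (f (p m))) (dil M t m) \<le> t * (\<epsilon>' * (K + 1))"
      if m: "m \<in> cball 0 \<eta>" for m
    proof -
      have u0: "dG (u m) 0 \<le> K + 1"
        using G.d_triangle[of "u m" 0 v] uv[OF m] v(2) by linarith
      have h0: "dG (dil G t (u m)) 0 = t * dG (u m) 0" using t(1) by (rule G.d_dil_0)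
      also have "\<dots> \<le> t * (K + 1)" using u0 t by (intro mult_left_mono) auto
      finally have h1: "dG (dil G t (u m)) 0 \<le> t * (K + 1)" .
      also have "\<dots> < c2" using t K by (simp add: field_simps)
      finally have "p m \<in> U \<and> dM (mul M (- f x) (f (p m))) (L (dil G t (u m))) \<le> \<epsilon>' * dG (dil G t (u m)) 0"
        using c2(2) unfolding p_def by blast
      moreover have "L (dil G t (u m)) = dil M t m" by (simp add: h_hom_dil[OF L t(1)] Lu)
      moreover have "\<epsilon>' * dG (dil G t (u m)) 0 \<le> \<epsilon>' * (t * (K + 1))"
        using h1 \<epsilon>' by (intro mult_left_mono) auto
      ultimately show ?thesis by (simp add: algebra_simps)
    qed
    have F_close: "dist m (F m) < \<eta>" if m: "m \<in> cball 0 \<eta>" for m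
    proof -
      have "dM m (F m) = dM (dil M (1 / t) (dil M t m)) (dil M (1 / t) (mul M (- f x) (f (p m))))"
        using t by (simp add: F_def)
      also have "\<dots> = 1 / t * dM (mul M (- f x) (f (p m))) (dil M t m)"
        using t by (subst M.d_dil) (simp_all add: M.d_sym[of "dil M t m"])
      also have "\<dots> \<le> 1 / t * (t * (\<epsilon>' * (K + 1)))"
        using main[OF m] t by (intro mult_left_mono) auto
      also have "\<dots> < c1" using \<epsilon>'(2) t by simp
      finally show ?thesis using c1(2)[OF m] by blast
    qed
    have "continuous_on (cball 0 \<eta>) p"
      unfolding p_def u_def
      by (intro continuous_on_compose2[OF G.continuous_on_mul[of UNIV]] G.continuous_on_dil
          continuous_on_const h_hom_continuous[OF R] subset_UNIV)
    then have "continuous_on (cball 0 \<eta>) (\<lambda>m. f (p m))"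
      using main by (intro continuous_on_compose2[OF f]) auto
    then have cont: "continuous_on (cball 0 \<eta>) (\<lambda>m. m - F m)"
      unfolding F_def
      by (intro continuous_on_diff continuous_on_id M.continuous_on_dil continuous_on_const
          continuous_on_compose2[OF M.continuous_on_mul[of UNIV]] subset_UNIV)
    have into: "(\<lambda>m. m - F m) \<in> cball 0 \<eta> \<rightarrow> cball 0 \<eta>"
    proof
      fix m assume "m \<in> cball (0::'m) \<eta>"
      then have "dist m (F m) < \<eta>" by (rule F_close)
      then show "m - F m \<in> cball 0 \<eta>" by (simp add: dist_norm norm_minus_commute)
    qed
    obtain m where m: "m \<in> cball 0 \<eta>" "m - F m = m"
      using brouwer_ball[OF \<eta> cont into] by blast
    then have "dil M t (F m) = 0" by simp
    then have "mul M (- f x) (f (p m)) = 0" using t by (simp add: F_def)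
    then have "f (p m) = f x"
      using M.mul_minus_cancel[of "f x" "f (p m)"] by simp
    then have "p m \<in> ?S" using main[OF m(1)] by simp
    moreover have "u m = dil G (1 / t) (mul G (- x) (p m))" using t by (simp add: p_def)
    ultimately have "u m \<in> G.blowup ?S x t" by (auto simp: G.blowup_def)
    then show ?thesis using uv[OF m(1)] by auto
  qed
  show "\<exists>t\<^sub>0>0. \<forall>t. 0 < t \<and> t < t\<^sub>0 \<longrightarrow>
      (\<forall>a\<in>G.blowup ?S x t \<inter> dball dG K. \<exists>q\<in>{h. L h = 0}. dG a q < e) \<and>
      (\<forall>q\<in>{h. L h = 0} \<inter> dball dG K. \<exists>a\<in>G.blowup ?S x t. dG a q < e)"
  proof (intro exI conjI allI impI)
    show "0 < min (c / K) (c2 / (K + 1))" using c c2 K by simp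
  qed (use upper lower in \<open>auto simp: dball_def\<close>)
qed

text \<open>The left inverse makes \<open>f\<close> expand distances from \<open>x\<close> on
  \<open>V\<close>, so image points at scale \<open>t\<close> come only from points at scale
  \<open>t\<close>, where the linear approximation applies.\<close>

lemma image_blowup_limit:
  assumes U: "open U" "x \<in> U" and df: "P_diff G M dG dM f x L"
    and P: "h_hom M G P" and PL: "\<And>y. P (L y) = y"
  obtains V where "open V" "x \<in> V" "V \<subseteq> U" "M.blowup_limit (f ` V) (f x) (range L)"
proof -
  have L: "h_hom G M L" using df by (simp add: P_diff_def)
  obtain C where C: "0 < C" "\<And>h. dG (P h) 0 \<le> C * dM h 0" using hom_bound_rev[OF P] by blast
  have CL: "dG h 0 \<le> C * dM (L h) 0" for h using C(2)[of "L h"] by (simp add: PL)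
  \<comment> \<open>With this accuracy the error contributes half of \<open>dG h 0\<close>, which is
    absorbed on the left in \<open>inj\<close>.\<close>
  have "0 < 1 / (2 * C)" using C by simp
  then obtain c where c: "0 < c" "\<And>h. dG h 0 < c \<Longrightarrow>
      mul G x h \<in> U \<and> dM (mul M (- f x) (f (mul G x h))) (L h) \<le> 1 / (2 * C) * dG h 0"
    using P_diff_bound[OF df U] by blast
  \<comment> \<open>\<open>V\<close> is fixed before \<open>K\<close> and \<open>e\<close>; the
    later radius \<open>c1\<close> depends on both and only restricts the scale.\<close>
  define V where "V = {y. dG y x < c} \<inter> U"
  have V: "open V" "x \<in> V" "V \<subseteq> U"
    using U c(1) unfolding V_def
    by (auto intro!: open_Int open_Collect_less G.continuous_on_d continuous_on_id continuous_on_const)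
  have inj: "dG h 0 \<le> 2 * C * dM (mul M (- f x) (f (mul G x h))) 0" if h: "dG h 0 < c" for h
  proof -
    let ?y = "mul M (- f x) (f (mul G x h))"
    have "dG h 0 \<le> C * dM (L h) 0" by (rule CL)
    also have "\<dots> \<le> C * (dM ?y (L h) + dM ?y 0)"
      using M.d_triangle[of "L h" 0 ?y] M.d_sym[of "L h" ?y] C by (intro mult_left_mono) auto
    also have "\<dots> \<le> C * (1 / (2 * C) * dG h 0 + dM ?y 0)"
      using c(2)[OF h] C by (intro mult_left_mono add_right_mono) auto
    also have "\<dots> = dG h 0 / 2 + C * dM ?y 0" using C by (simp add: field_simps)
    finally show ?thesis by simp
  qed
  have "M.blowup_limit (f ` V) (f x) (range L)"
    unfolding M.blowup_limit_def
  proof (intro allI impI)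
    fix K e :: real assume K: "0 < K" and e: "0 < e"
    define \<epsilon> where "\<epsilon> = e / (4 * C * K)"
    have \<epsilon>: "0 < \<epsilon>" "\<epsilon> * (2 * C * K) < e" using e C K by (simp_all add: \<epsilon>_def)
    obtain c1 where c1: "0 < c1" "\<And>h. dG h 0 < c1 \<Longrightarrow>
        mul G x h \<in> U \<and> dM (mul M (- f x) (f (mul G x h))) (L h) \<le> \<epsilon> * dG h 0"
      using P_diff_bound[OF df U \<epsilon>(1)] by blast
    \<comment> \<open>\<open>2 * C * K\<close> bounds the blown-up preimages of points in the ball
      of radius \<open>K\<close>; the choice of \<open>\<epsilon>\<close> then makes the error at
      most \<open>e / 2\<close>.\<close>
    have near: "dM (dil M (1 / t) (mul M (- f x) (f (mul G x h)))) (L (dil G (1 / t) h)) < e"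
      if t: "0 < t" and h: "dG h 0 \<le> t * (2 * C * K)" "dG h 0 < c1" for t h
    proof -
      have "dM (dil M (1 / t) (mul M (- f x) (f (mul G x h)))) (L (dil G (1 / t) h))
          = 1 / t * dM (mul M (- f x) (f (mul G x h))) (L h)"
        using t by (simp add: h_hom_dil[OF L] M.d_dil)
      also have "\<dots> \<le> 1 / t * (\<epsilon> * (t * (2 * C * K)))"
        using order_trans[OF conjunct2[OF c1(2)[OF h(2)]] mult_left_mono[OF h(1), of \<epsilon>]] \<epsilon>(1) t
        by (intro mult_left_mono) auto
      also have "\<dots> = \<epsilon> * (2 * C * K)" using t by simp
      finally show ?thesis using \<epsilon>(2) by simp
    qed
    have small: "t * (2 * C * K) < min c c1" if "t < min c c1 / (2 * C * K)" for t
      using that C K by (simp add: pos_less_divide_eq)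
    have upper: "\<exists>q\<in>range L. dM a q < e"
      if t: "0 < t" "t < min c c1 / (2 * C * K)" and a: "a \<in> M.blowup (f ` V) (f x) t \<inter> dball dM K" for t a
    proof -
      obtain y where y: "y \<in> V" "a = dil M (1 / t) (mul M (- f x) (f y))"
        using a by (auto simp: M.blowup_def)
      have a0: "dM a 0 \<le> K" using a by (simp add: dball_def)
      define h where "h = mul G (- x) y"
      have h: "mul G x h = y" "dG h 0 < c" using y(1) by (simp_all add: h_def V_def G.d_mul_minus)
      have "mul M (- f x) (f y) = dil M t a" using t y by simp
      then have "dG h 0 \<le> 2 * C * (t * dM a 0)"
        using inj[OF h(2)] by (simp add: h(1) M.d_dil_0[OF t(1)])
      also have "\<dots> \<le> 2 * C * (t * K)" using a0 t C by (intro mult_left_mono) auto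
      finally have h0: "dG h 0 \<le> t * (2 * C * K)" by (simp add: algebra_simps)
      then have "dM a (L (dil G (1 / t) h)) < e"
        using near[OF t(1), of h] small[OF t(2)] by (simp add: y h)
      then show ?thesis by blast
    qed
    have lower: "\<exists>a\<in>M.blowup (f ` V) (f x) t. dM a q < e"
      if t: "0 < t" "t < min c c1 / (2 * C * K)" and q: "q \<in> range L \<inter> dball dM K" for t q
    proof -
      obtain u where u: "q = L u" using q by blast
      have "dG u 0 \<le> C * K"
        using q C by (intro order_trans[OF CL[of u]] mult_left_mono) (auto simp: u dball_def)
      also have "\<dots> \<le> 2 * C * K" using C K by simp
      finally have u0: "dG u 0 \<le> 2 * C * K" .
      define h where "h = dil G t u"
      have h0: "dG h 0 \<le> t * (2 * C * K)"
        unfolding h_def G.d_dil_0[OF t(1)] using u0 t by (intro mult_left_mono) auto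
      then have h1: "dG h 0 < c" "dG h 0 < c1" using small[OF t(2)] by auto
      have "mul G x h \<in> V"
        using c(2)[OF h1(1)] h1(1) by (simp add: V_def G.d_mul_self)
      then have "dil M (1 / t) (mul M (- f x) (f (mul G x h))) \<in> M.blowup (f ` V) (f x) t"
        by (auto simp: M.blowup_def)
      moreover have "dil G (1 / t) h = u" using t by (simp add: h_def)
      ultimately show ?thesis using near[OF t(1) h0 h1(2)] u by auto
    qed
    show "\<exists>t\<^sub>0>0. \<forall>t. 0 < t \<and> t < t\<^sub>0 \<longrightarrow>
        (\<forall>a\<in>M.blowup (f ` V) (f x) t \<inter> dball dM K. \<exists>q\<in>range L. dM a q < e) \<and>
        (\<forall>q\<in>range L \<inter> dball dM K. \<exists>a\<in>M.blowup (f ` V) (f x) t. dM a q < e)"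
    proof (intro exI conjI allI impI)
      show "0 < min c c1 / (2 * C * K)" using c(1) c1(1) C K by simp
    qed (use upper lower in blast)+
  qed
  with V that show ?thesis by blast
qed

end

theorem theorem1p6:
  fixes G :: "'g::euclidean_space grstr" and M :: "'m::euclidean_space grstr"
    and dG :: "'g \<Rightarrow> 'g \<Rightarrow> real" and dM :: "'m \<Rightarrow> 'm \<Rightarrow> real"
    and f :: "'g \<Rightarrow> 'm" and Df :: "'g \<Rightarrow> 'g \<Rightarrow> 'm"
    and \<Omega> :: "'g set" and xb :: 'g
  assumes "stratified_group G" and "graded_group M"
    and "hom_dist G dG" and "hom_dist M dM"
    and "open \<Omega>" and "xb \<in> \<Omega>"
    and "\<forall>x\<in>\<Omega>. P_diff G M dG dM f x (Df x)"
    and "\<forall>h. continuous_on \<Omega> (\<lambda>x. Df x h)"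
  shows
    "(h_epi G M (Df xb) \<and> (\<exists>W. homog_subgroup G W \<and> complementary G {h. Df xb h = 0} W)
      \<longrightarrow> (let S = {x\<in>\<Omega>. f x = f xb}; N = {h. Df xb h = 0} in
            (\<forall>R>0. ((\<lambda>t. hdist dG (dball dG R \<inter> dil G (1 / t) ` (mul G (- xb) ` S))
                                  (dball dG R \<inter> N)) \<longlongrightarrow> 0) (at_right 0))
            \<and> Tan G S xb = N))
   \<and> (h_mono G M (Df xb) \<and> (\<exists>W. homog_subgroup M W \<and> normal_sub M W
                                  \<and> complementary M (range (Df xb)) W)
      \<longrightarrow> (\<exists>V. open V \<and> xb \<in> V \<and> V \<subseteq> \<Omega> \<and>
            (let S = f ` V; H = range (Df xb) in
              (\<forall>R>0. ((\<lambda>t. hdist dM (dball dM R \<inter> dil M (1 / t) ` (mul M (- f xb) ` S))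
                                    (dball dM R \<inter> H)) \<longlongrightarrow> 0) (at_right 0))
              \<and> Tan M S (f xb) = H)))"
proof -
  interpret homogeneous_pair G dG M dM
    using assms by unfold_locales (auto simp: stratified_group_def)
  have df: "P_diff G M dG dM f xb (Df xb)" using assms by blast
  have L: "h_hom G M (Df xb)" using df by (simp add: P_diff_def)
  \<comment> \<open>Differentiability at every point of the open set yields the continuity that
    Brouwer's theorem requires.\<close>
  have f: "continuous_on \<Omega> f"
    using assms(7) P_diff_isCont by (blast intro: continuous_at_imp_continuous_on)
  show ?thesis
  proof (intro conjI impI, goal_cases)
    case 1
    then obtain R where R: "h_hom M G R" "\<And>y. Df xb (R y) = y"
      unfolding h_epi_def by blast
    define S where "S = {x\<in>\<Omega>. f x = f xb}"
    have lim: "G.blowup_limit S xb {h. Df xb h = 0}"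
      unfolding S_def using level_set_blowup_limit[OF assms(5,6) f df R] .
    have "xb \<in> S" using assms(6) by (simp add: S_def)
    then show ?case
      unfolding Let_def S_def[symmetric] G.blowup_def[symmetric]
      using G.hdist_blowup_tendsto[OF cone_kernel[OF L] lim] G.Tan_eq_of_blowup_limit[OF cone_kernel[OF L] lim]
      by blast
  next
    case 2
    then obtain P where P: "h_hom M G P" "\<And>y. P (Df xb y) = y"
      unfolding h_mono_def by blast
    obtain V where V: "open V" "xb \<in> V" "V \<subseteq> \<Omega>" and
      lim: "M.blowup_limit (f ` V) (f xb) (range (Df xb))"
      using image_blowup_limit[OF assms(5,6) df P] by blast
    note cone = cone_range[OF L P]
    show ?case
      unfolding Let_def M.blowup_def[symmetric]
      using V M.hdist_blowup_tendsto[OF cone lim imageI[OF V(2)]] M.Tan_eq_of_blowup_limit[OF cone lim]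
      by blast
  qed
qed

end
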